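(* Let $a, b \in \mathbb{R}$, $m \in \mathbb{N}$ and $k, p \in \mathbb{R}^{+}$. Define $$\mathcal{G}(k,m,a,b,p) = \int_0^\infty x^{k-1} Q_m(a, b\sqrt{x})\, e^{-px}\,{\rm d}x .$$ Then $$\mathcal{G}(k,m,a,b,p) = \frac{\Gamma(k)}{p^k} - \left(\frac{2}{b^2+2p}\right)^{k} e^{-\frac{a^2}{2}}\,\Gamma(k)\left[\Phi_1\!\left(k,1,1;\frac{b^2}{b^2+2p},\frac{a^2b^2}{2b^2+4p}\right) - \sum_{n=0}^{m-1}\frac{(k)_n}{n!}\left(\frac{b^2}{b^2+2p}\right)^{n} {}_1F_1\!\left(k+n;n+1;\frac{a^2b^2}{2b^2+4p}\right)\right].$$
   Context: $Q_m(\alpha,\beta)$ is the generalized Marcum $Q$-function, $Q_m(\alpha,\beta) = \alpha^{1-m}\int_\beta^\infty t^{m} e^{-(t^2+\alpha^2)/2} I_{m-1}(\alpha t)\,{\rm d}t$ (with the limiting value for $\alpha=0$), where $I_{\nu}$ is the modified Bessel function of the first kind. $\Gamma$ is the Euler Gamma function, $(x)_n=\Gamma(x+n)/\Gamma(x)$ is the Pochhammer symbol, ${}_1F_1(\alpha;\gamma;z)=\sum_{l\ge 0}\frac{(\alpha)_l}{(\gamma)_l}\frac{z^l}{l!}$ is the Kummer confluent hypergeometric function, and $\Phi_1$ is the Humbert hypergeometric function of the first kind, $\Phi_1(\alpha,\beta,\gamma;x,y)=\sum_{n\ge0}\sum_{l\ge0}\frac{(\alpha)_{n+l}(\beta)_n}{(\gamma)_{n+l}}\frac{x^n}{n!}\frac{y^l}{l!}$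 for $|x|<1$. *)

theory Defs
  imports "HOL-Analysis.Analysis"
begin

definition besselI :: "nat \<Rightarrow> real \<Rightarrow> real" where
  "besselI n z = (\<Sum>j. (z / 2) ^ (2 * j + n) / (fact j * Gamma (real (j + n) + 1)))"

definition marcumQ_int :: "nat \<Rightarrow> real \<Rightarrow> real \<Rightarrow> real" where
  "marcumQ_int m \<alpha> \<beta> =
     \<alpha> powi (1 - int m) *
     (LBINT t:{\<beta>..}. t ^ m * exp (- (t\<^sup>2 + \<alpha>\<^sup>2) / 2) * besselI (m - 1) (\<alpha> * t))"

text \<open>Generalized Marcum Q-function, with the limiting value at alpha = 0
  (m \<ge> 1 is assumed wherever it is used, so that I_(m-1) has order m-1).\<close>
definition marcumQ :: "nat \<Rightarrow> real \<Rightarrow> real \<Rightarrow> real" where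
  "marcumQ m \<alpha> \<beta> =
     (if \<alpha> = 0 then Lim (at 0) (\<lambda>a. marcumQ_int m a \<beta>) else marcumQ_int m \<alpha> \<beta>)"

definition hyp1F1 :: "real \<Rightarrow> real \<Rightarrow> real \<Rightarrow> real" where
  "hyp1F1 \<alpha> \<gamma> z = (\<Sum>l. pochhammer \<alpha> l / pochhammer \<gamma> l * z ^ l / fact l)"

text \<open>Humbert hypergeometric function Phi_1 (series, for |x| < 1).\<close>
definition humbertPhi1 :: "real \<Rightarrow> real \<Rightarrow> real \<Rightarrow> real \<Rightarrow> real \<Rightarrow> real" where
  "humbertPhi1 \<alpha> \<beta> \<gamma> x y =
     (\<Sum>n. \<Sum>l. pochhammer \<alpha> (n + l) * pochhammer \<beta> n / pochhammer \<gamma> (n + l)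
                 * x ^ n / fact n * y ^ l / fact l)"

definition calG :: "real \<Rightarrow> nat \<Rightarrow> real \<Rightarrow> real \<Rightarrow> real \<Rightarrow> real" where
  "calG k m a b p = (LBINT x:{0<..}. x powr (k - 1) * marcumQ m a (b * sqrt x) * exp (- p * x))"

end

theory Submission
  imports Defs "HOL-Probability.Distributions"
begin

text \<open>Integrating the Bessel series term by term exhibits the Marcum function as a Poisson mixture:
  $Q_m(a,\beta) = e^{-w} \sum_j \frac{w^j}{j!}\, P(N_u < j + m)$ with $w = a^2/2$, $u = \beta^2/2$ and
  $N_u$ Poisson distributed with mean $u$. For $\beta = b \sqrt{x}$ the probability is a finite sum
  of terms $e^{-u} u^i / i!$, each of which turns into a Gamma integral, so the Laplace-type
  integral becomes $e^{-w} \sum_j \frac{w^j}{j!} \sum_{i<j+m} h_i$ with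
  $h_i = \frac{\Gamma(k)}{(p+c)^k} \frac{(k)_i}{i!} X^i$, $c = b^2/2$, $X = c/(p+c)$.
  By the binomial series, replacing the inner sum by the full one gives $\Gamma(k)/p^k$; the missing
  tails $i = n + j$, $n \ge m$, are the terms of $\Phi_1$ with the first $m$ Kummer rows removed.\<close>

section \<open>Poisson distribution function\<close>

definition poisson_below :: "nat \<Rightarrow> real \<Rightarrow> real" where
  "poisson_below N u = exp (- u) * (\<Sum>i<N. u ^ i / fact i)"

lemma poisson_below_nonneg: "u \<ge> 0 \<Longrightarrow> poisson_below N u \<ge> 0"
  by (auto simp: poisson_below_def intro!: sum_nonneg mult_nonneg_nonneg)

lemma poisson_below_le_1:
  assumes "u \<ge> 0"
  shows "poisson_below N u \<le> 1"
proof -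
  have s: "(\<lambda>i. u ^ i / fact i) sums exp u"
    using exp_converges[of u] by (simp add: field_simps)
  have "(\<Sum>i<N. u ^ i / fact i) \<le> exp u"
    using sum_le_suminf[OF sums_summable[OF s], of "{..<N}"] sums_unique[OF s] assms by simp
  then show ?thesis
    by (simp add: poisson_below_def exp_minus field_simps)
qed

text \<open>Differentiating the summand with index i > 0 gives the Poisson weight at i - 1 minus the
  weight at i, so the sum telescopes and only the weight at the top index \<open>n\<close> is left,
  with a minus sign. This makes the function a primitive for odd powers times a Gaussian.\<close>

lemma poisson_below_has_real_derivative:
  "(poisson_below (Suc n) has_real_derivative - (exp (- u) * u ^ n / fact n)) (at u)"
proof (induction n)
  case 0
  show ?case
    unfolding poisson_below_def by (auto intro!: derivative_eq_intros)
next
  case (Suc n)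
  have eq: "poisson_below (Suc (Suc n)) =
      (\<lambda>u. poisson_below (Suc n) u + exp (- u) * u ^ Suc n / fact (Suc n))"
    by (simp add: poisson_below_def fun_eq_iff algebra_simps)
  have "((\<lambda>u. exp (- u) * u ^ Suc n / fact (Suc n)) has_real_derivative
      exp (- u) * u ^ n / fact n - exp (- u) * u ^ Suc n / fact (Suc n)) (at u)"
    by (auto intro!: derivative_eq_intros simp del: power_Suc simp: divide_simps)
  from DERIV_add[OF Suc this] show ?case
    unfolding eq by simp
qed

lemma poisson_below_tendsto_0: "(poisson_below N \<longlongrightarrow> 0) at_top"
proof -
  have "((\<lambda>u::real. \<Sum>i<N. (u ^ i / exp u) / fact i) \<longlongrightarrow> (\<Sum>i<N. 0 / fact i)) at_top"
    by (intro tendsto_sum tendsto_divide tendsto_const tendsto_power_div_exp_0) auto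
  moreover have "poisson_below N = (\<lambda>u. \<Sum>i<N. (u ^ i / exp u) / fact i)"
    by (simp add: poisson_below_def fun_eq_iff sum_distrib_left exp_minus field_simps)
  ultimately show ?thesis by simp
qed

section \<open>Gaussian moments and tail integrals\<close>

lemma integrable_power_gaussian: "integrable lborel (\<lambda>t::real. t ^ n * exp (- t\<^sup>2 / 2))"
proof -
  have "integrable lborel (\<lambda>t. sqrt (2 * pi) * (std_normal_density t * t ^ n))"
    by (intro integrable_mult_right integrable_std_normal_moment)
  then show ?thesis
    by (simp add: std_normal_density_def mult_ac)
qed

text \<open>An absolute odd moment of the standard normal law, freed of the normalisation
  \<open>sqrt (2 * pi)\<close>. It supplies the majorant when the Bessel series is integrated term
  by term.\<close>

lemma integral_abs_odd_power_gaussian: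
  "(\<integral>t. \<bar>(t::real) ^ (2 * n + 1) * exp (- t\<^sup>2 / 2)\<bar> \<partial>lborel) = 2 * 2 ^ n * fact n"
proof -
  have "(\<integral>t. \<bar>t ^ (2 * n + 1) * exp (- t\<^sup>2 / 2)\<bar> \<partial>lborel)
      = (\<integral>t. sqrt (2 * pi) * (std_normal_density t * \<bar>t\<bar> ^ (2 * n + 1)) \<partial>lborel)"
    by (intro Bochner_Integration.integral_cong)
       (simp_all add: std_normal_density_def abs_mult power_abs mult_ac del: power_Suc)
  also have "\<dots> = sqrt (2 * pi) * (sqrt (2 / pi) * 2 ^ n * fact n)"
    by (simp only: integral_mult_right_zero integral_std_normal_moment_abs_odd)
  also have "sqrt (2 * pi) * sqrt (2 / pi) = 2"
    by (simp add: real_sqrt_mult[symmetric])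
  then have "sqrt (2 * pi) * (sqrt (2 / pi) * 2 ^ n * fact n) = 2 * 2 ^ n * fact n"
    by (metis mult.assoc)
  finally show ?thesis .
qed

text \<open>By the chain rule with u = t^2 / 2 the integrand is, on the whole real line, the
  derivative of \<open>- (2 ^ n * fact n)\<close> times the Poisson function, which tends to 0 at
  infinity. Hence \<open>\<beta>\<close> may have either sign.\<close>

lemma integral_odd_power_gaussian_tail:
  "(LBINT t:{\<beta>..}. t ^ (2 * n + 1) * exp (- t\<^sup>2 / 2))
     = 2 ^ n * fact n * poisson_below (Suc n) (\<beta>\<^sup>2 / 2)"
proof -
  let ?f = "\<lambda>t::real. t ^ (2 * n + 1) * exp (- t\<^sup>2 / 2)"
  define F where "F t = - (2 ^ n * fact n * poisson_below (Suc n) (t\<^sup>2 / 2))" for t :: real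
  have dF: "(F has_real_derivative ?f t) (at t)" for t
  proof -
    have "((\<lambda>t. poisson_below (Suc n) (t\<^sup>2 / 2)) has_real_derivative
        - (exp (- (t\<^sup>2 / 2)) * (t\<^sup>2 / 2) ^ n / fact n) * t) (at t)"
      by (rule DERIV_chain2[OF poisson_below_has_real_derivative])
         (auto intro!: derivative_eq_intros)
    from DERIV_minus[OF DERIV_cmult[OF this, of "2 ^ n * fact n"]]
    show ?thesis
      unfolding F_def
      by (simp add: power_divide power_mult[symmetric] mult_ac)
  qed
  have int: "set_integrable lborel A ?f" if "A \<in> sets borel" for A
    unfolding set_integrable_def
    by (intro integrable_mult_indicator integrable_power_gaussian) (use that in auto)
  have meas: "set_borel_measurable lborel A ?f" if "A \<in> sets borel" for A
    using int[OF that] by (simp add: set_integrable_def set_borel_measurable_def)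
  \<comment> \<open>The endpoint is a null set; the interval integral is taken over the open
    ray.\<close>
  have "(LBINT t:{\<beta>..}. ?f t) = (LBINT t:{\<beta><..}. ?f t)"
  proof (rule set_integral_cong_set)
    show "AE x in lborel. (x \<in> {\<beta><..}) = (x \<in> {\<beta>..})"
      using AE_lborel_singleton[of \<beta>] by eventually_elim auto
  qed (rule meas, simp)+
  also have "\<dots> = (LBINT t=ereal \<beta>..\<infinity>. ?f t)"
    by (simp only: interval_integral_to_infinity_eq)
  also have "\<dots> = 0 - F \<beta>"
  proof (rule interval_integral_FTC_integrable)
    show "(F has_vector_derivative ?f t) (at t)" for t
      using dF by (simp add: has_real_derivative_iff_has_vector_derivative)
    show "isCont ?f t" for t
      by (intro continuous_intros) auto
    show "set_integrable lborel (einterval (ereal \<beta>) \<infinity>) ?f"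
      by (intro int) auto
    show "((F \<circ> real_of_ereal) \<longlongrightarrow> F \<beta>) (at_right (ereal \<beta>))"
      unfolding ereal_tendsto_simps
      using DERIV_isCont[OF dF] by (simp add: isCont_def filterlim_at_split)
    have "filterlim (\<lambda>t::real. t\<^sup>2 / 2) at_top at_top"
      by real_asymp
    from filterlim_compose[OF poisson_below_tendsto_0 this]
    have "(F \<longlongrightarrow> - (2 ^ n * fact n * 0)) at_top"
      unfolding F_def by (intro tendsto_intros)
    then show "((F \<circ> real_of_ereal) \<longlongrightarrow> 0) (at_left \<infinity>)"
      unfolding ereal_tendsto_simps by simp
  qed auto
  finally show ?thesis by (simp add: F_def)
qed

section \<open>Marcum function as a Poisson mixture\<close>

text \<open>The probabilities are at most 1, so the exponential series dominates. Here
  \<open>w\<close> ranges over all reals, so that the mixture can be read as an everywhere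
  convergent power series in \<open>w\<close>.\<close>

lemma summable_poisson_mixture:
  assumes "u \<ge> 0"
  shows "summable (\<lambda>j. w ^ j / fact j * poisson_below (j + m) u)"
proof (rule summable_comparison_test')
  show "summable (\<lambda>j. \<bar>w\<bar> ^ j / fact j)"
    using summable_exp[of "\<bar>w\<bar>"] by (simp add: field_simps)
  show "norm (w ^ j / fact j * poisson_below (j + m) u) \<le> \<bar>w\<bar> ^ j / fact j" for j
    using mult_left_mono[OF poisson_below_le_1[OF assms, of "j + m"], of "\<bar>w\<bar> ^ j / fact j"]
      poisson_below_nonneg[OF assms, of "j + m"]
    by (simp add: abs_mult power_abs)
qed

text \<open>Termwise the integrand is an odd power of t times a Gaussian, so its primitive is explicit
  and the formula needs no sign condition on either argument.\<close>

lemma marcumQ_int_eq: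
  assumes "m \<ge> 1" "a \<noteq> 0"
  shows "marcumQ_int m a \<beta> =
    exp (- a\<^sup>2 / 2) * (\<Sum>j. (a\<^sup>2 / 2) ^ j / fact j * poisson_below (j + m) (\<beta>\<^sup>2 / 2))"
proof -
  obtain r where m: "m = Suc r"
    using assms(1) by (cases m) auto
  define w where "w = a\<^sup>2 / 2"
  have w: "w \<ge> 0" by (simp add: w_def)
  \<comment> \<open>What remains of the j-th Bessel coefficient with r = m - 1 after the factor from
    the Gaussian and all powers of \<open>a\<close> have been absorbed; \<open>g j\<close> is the
    j-th term of the full integrand.\<close>
  define C where "C j = exp (- w) * w ^ j / (fact j * fact (j + r) * 2 ^ (j + r))" for j
  have C0: "C j \<ge> 0" for j
    using w by (simp add: C_def)
  define g where "g j t = C j * (t ^ (2 * (j + r) + 1) * exp (- t\<^sup>2 / 2))" for j and t :: real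
  have sw: "summable (\<lambda>j. w ^ j / fact j)"
    using summable_exp[of w] by (simp add: field_simps)
  have bessel_sum: "summable (\<lambda>j. norm (g j t))" for t
  proof (rule summable_comparison_test')
    show "summable (\<lambda>j. \<bar>t\<bar> ^ (2 * r + 1) * ((w * t\<^sup>2) ^ j / fact j))"
      using summable_exp[of "w * t\<^sup>2"] by (intro summable_mult) (simp add: field_simps)
    fix j
    \<comment> \<open>Dropping the factors \<open>fact (j + r)\<close> and
      \<open>2 ^ (j + r)\<close>, both at least 1, leaves the exponential series of w t^2 as
      majorant.\<close>
    have "fact j * 1 * 1 \<le> (fact j * fact (j + r) * 2 ^ (j + r) :: real)"
      by (intro mult_mono fact_ge_1) auto
    then have "1 / (fact j * fact (j + r) * 2 ^ (j + r)) \<le> (1 / fact j :: real)"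
      by (intro divide_left_mono) auto
    moreover have "exp (- w) \<le> 1" "exp (- t\<^sup>2 / 2) \<le> 1"
      using w by auto
    ultimately have "exp (- w) * (w ^ j * (1 / (fact j * fact (j + r) * 2 ^ (j + r)))) *
        (\<bar>t\<bar> ^ (2 * (j + r) + 1) * exp (- t\<^sup>2 / 2))
      \<le> 1 * (w ^ j * (1 / fact j)) * (\<bar>t\<bar> ^ (2 * (j + r) + 1) * 1)"
      using w by (intro mult_mono mult_nonneg_nonneg) auto
    also have "\<dots> = \<bar>t\<bar> ^ (2 * r + 1) * ((w * t\<^sup>2) ^ j / fact j)"
      by (simp add: power_add power_mult power_mult_distrib)
    finally show "norm (norm (g j t)) \<le> \<bar>t\<bar> ^ (2 * r + 1) * ((w * t\<^sup>2) ^ j / fact j)"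
      using w by (simp add: g_def C_def abs_mult power_abs)
  qed
  \<comment> \<open>The prefactor is a^(-r); it cancels the a^r of the Bessel term, so only powers
    of a^2, that is of \<open>w\<close>, survive.\<close>
  have scale: "a powi (1 - int m) * (t ^ m * exp (- (t\<^sup>2 + a\<^sup>2) / 2) *
      ((a * t / 2) ^ (2 * j + (m - 1)) / (fact j * Gamma (real (j + (m - 1)) + 1)))) = g j t" for j t
  proof -
    have G: "Gamma (real (j + r) + 1) = fact (j + r)"
      by (metis Gamma_fact add.commute)
    have A: "a powi (1 - int m) = inverse (a ^ r)"
      by (simp add: m power_int_minus)
    have E: "exp (- (t\<^sup>2 + a\<^sup>2) / 2) = exp (- w) * exp (- t\<^sup>2 / 2)"
      by (simp add: w_def exp_add[symmetric] add_divide_distrib diff_divide_distrib)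
    have P: "(a * t / 2) ^ (2 * j + r) = a ^ r * w ^ j * t ^ (2 * j + r) / 2 ^ (j + r)"
      by (simp only: w_def power_mult_distrib power_divide power_add mult_2 power2_eq_square)
         (simp add: mult_ac)
    show ?thesis
      unfolding A E unfolding m diff_Suc_1 P G using assms(2)
      by (simp add: g_def C_def power_add mult_2 mult_2_right mult_ac)
  qed
  have "marcumQ_int m a \<beta> = (LBINT t:{\<beta>..}. \<Sum>j. g j t)"
  proof -
    have "a powi (1 - int m) * (t ^ m * exp (- (t\<^sup>2 + a\<^sup>2) / 2) * besselI (m - 1) (a * t))
        = (\<Sum>j. g j t)" for t
    proof -
      define d where "d = a powi (1 - int m) * (t ^ m * exp (- (t\<^sup>2 + a\<^sup>2) / 2))"
      have e: "g j t = d * ((a * t / 2) ^ (2 * j + (m - 1)) /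
          (fact j * Gamma (real (j + (m - 1)) + 1)))" for j
        using scale[of t j] by (simp only: d_def mult.assoc)
      \<comment> \<open>Convergence of the Bessel series is recovered from that of \<open>g\<close>
        by dividing by \<open>d\<close>. The value d = 0 occurs only at t = 0, where both sides
        vanish.\<close>
      have "summable (\<lambda>j. (a * t / 2) ^ (2 * j + (m - 1)) /
          (fact j * Gamma (real (j + (m - 1)) + 1)))" if "d \<noteq> 0"
        using summable_norm_cancel[OF bessel_sum[of t]] that unfolding e
        by (simp only: summable_cmult_iff) simp
      then have "(\<Sum>j. g j t) = d * besselI (m - 1) (a * t)"
        unfolding e besselI_def by (cases "d = 0") (simp, simp only: suminf_mult not_False_eq_True)
      then show ?thesis
        by (simp only: d_def mult.assoc)
    qed
    then show ?thesis
      unfolding marcumQ_int_def by (simp flip: set_integral_mult_right)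
  qed
  also have "\<dots> = (\<integral>t. (\<Sum>j. indicator {\<beta>..} t *\<^sub>R g j t) \<partial>lborel)"
    unfolding set_lebesgue_integral_def
  proof (intro Bochner_Integration.integral_cong refl)
    fix t
    show "indicator {\<beta>..} t *\<^sub>R (\<Sum>j. g j t) = (\<Sum>j. indicator {\<beta>..} t *\<^sub>R g j t)"
      by (cases "t \<in> {\<beta>..}") auto
  qed
  also have "\<dots> = (\<Sum>j. LBINT t:{\<beta>..}. g j t)"
    unfolding set_lebesgue_integral_def
  proof (rule integral_suminf)
    have gi: "integrable lborel (g j)" for j
      unfolding g_def by (intro integrable_mult_right integrable_power_gaussian)
    show ii: "integrable lborel (\<lambda>t. indicator {\<beta>..} t *\<^sub>R g j t)" for j
      by (intro integrable_mult_indicator gi) auto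
    show "AE t in lborel. summable (\<lambda>j. norm (indicator {\<beta>..} t *\<^sub>R g j t))"
      using bessel_sum by (intro AE_I2) (auto simp: indicator_def)
    show "summable (\<lambda>j. \<integral>t. norm (indicator {\<beta>..} t *\<^sub>R g j t) \<partial>lborel)"
    proof (rule summable_comparison_test')
      \<comment> \<open>The absolute moment over the whole line cancels
        \<open>fact (j + r) * 2 ^ (j + r)\<close> in \<open>C j\<close>, which leaves twice a
        Poisson weight.\<close>
      show "summable (\<lambda>j. exp (- w) * 2 * (w ^ j / fact j))"
        by (intro summable_mult sw)
      fix j
      have "(\<integral>t. norm (indicator {\<beta>..} t *\<^sub>R g j t) \<partial>lborel) \<le> (\<integral>t. norm (g j t) \<partial>lborel)"
        using gi ii by (intro integral_mono) (auto simp: indicator_def)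
      also have "\<dots> = C j * (2 * 2 ^ (j + r) * fact (j + r))"
        using integral_abs_odd_power_gaussian[of "j + r"] C0[of j]
        unfolding g_def real_norm_def abs_mult[of "C j"] by simp
      also have "\<dots> = exp (- w) * 2 * (w ^ j / fact j)"
        by (simp add: C_def)
      finally show "norm (\<integral>t. norm (indicator {\<beta>..} t *\<^sub>R g j t) \<partial>lborel)
          \<le> exp (- w) * 2 * (w ^ j / fact j)"
        by simp
    qed
  qed
  also have "(\<lambda>j. LBINT t:{\<beta>..}. g j t)
      = (\<lambda>j. exp (- w) * (w ^ j / fact j * poisson_below (j + m) (\<beta>\<^sup>2 / 2)))"
  proof
    fix j
    have "(LBINT t:{\<beta>..}. g j t) =
        C j * (2 ^ (j + r) * fact (j + r) * poisson_below (Suc (j + r)) (\<beta>\<^sup>2 / 2))"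
      unfolding g_def set_integral_mult_right integral_odd_power_gaussian_tail ..
    then show "(LBINT t:{\<beta>..}. g j t) = exp (- w) * (w ^ j / fact j * poisson_below (j + m) (\<beta>\<^sup>2 / 2))"
      by (simp add: C_def m)
  qed
  also have "(\<Sum>j. exp (- w) * (w ^ j / fact j * poisson_below (j + m) (\<beta>\<^sup>2 / 2)))
      = exp (- w) * (\<Sum>j. w ^ j / fact j * poisson_below (j + m) (\<beta>\<^sup>2 / 2))"
    by (intro suminf_mult summable_poisson_mixture) simp
  finally show ?thesis
    by (simp add: w_def)
qed

text \<open>At a = 0 the value is defined as a limit. The mixture is a power series in a^2 / 2
  converging everywhere, hence continuous, so the limit is its value at 0.\<close>

lemma marcumQ_eq:
  assumes "m \<ge> 1"
  shows "marcumQ m a \<beta> =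
    exp (- a\<^sup>2 / 2) * (\<Sum>j. (a\<^sup>2 / 2) ^ j / fact j * poisson_below (j + m) (\<beta>\<^sup>2 / 2))"
proof (cases "a = 0")
  case False
  then show ?thesis
    using marcumQ_int_eq[OF assms] by (simp add: marcumQ_def)
next
  case True
  define S where "S w = (\<Sum>j. poisson_below (j + m) (\<beta>\<^sup>2 / 2) / fact j * w ^ j)" for w :: real
  have S: "(\<Sum>j. w ^ j / fact j * poisson_below (j + m) (\<beta>\<^sup>2 / 2)) = S w" for w
    unfolding S_def by (simp add: mult_ac)
  have cont: "isCont S w" for w
    unfolding S_def
    by (rule isCont_powser_converges_everywhere)
       (use summable_poisson_mixture[of "\<beta>\<^sup>2 / 2" _ m] in \<open>simp add: mult_ac\<close>)
  have "isCont (\<lambda>x. exp (- x\<^sup>2 / 2) * S (x\<^sup>2 / 2)) 0"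
    by (intro continuous_intros isCont_o2[OF _ cont]) auto
  then have "((\<lambda>x. exp (- x\<^sup>2 / 2) * S (x\<^sup>2 / 2)) \<longlongrightarrow> S 0) (at 0)"
    by (simp add: isCont_def)
  then have "((\<lambda>x. marcumQ_int m x \<beta>) \<longlongrightarrow> S 0) (at 0)"
    by (rule Lim_transform_eventually)
       (simp add: eventually_at_filter marcumQ_int_eq[OF assms] S del: times_divide_eq_left)
  then have "Lim (at 0) (\<lambda>x. marcumQ_int m x \<beta>) = S 0"
    by (intro tendsto_Lim) auto
  then show ?thesis
    using True S[of 0] by (simp add: marcumQ_def)
qed

section \<open>Gamma integrals\<close>

text \<open>Euler's integral under the substitution t = q x; the factor
  \<open>q powr (1 - s)\<close> then removes the power of \<open>q\<close> from the
  integrand.\<close>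

lemma has_bochner_integral_Gamma_scaled:
  fixes s q :: real
  assumes "s > 0" "q > 0"
  shows "has_bochner_integral lborel
    (\<lambda>x. indicator {0<..} x *\<^sub>R (x powr (s - 1) * exp (- q * x))) (Gamma s / q powr s)"
proof -
  have "has_bochner_integral lborel (\<lambda>t. indicator {0..} t * t powr (s - 1) / exp t) (Gamma s)"
    using Gamma_conv_nn_integral_real[OF assms(1)] Gamma_real_pos[OF assms(1)]
    by (intro has_bochner_integral_nn_integral) (auto simp: less_imp_le)
  then have "has_bochner_integral lborel
      (\<lambda>x. indicator {0..} (0 + q * x) * (0 + q * x) powr (s - 1) / exp (0 + q * x)) (Gamma s /\<^sub>R \<bar>q\<bar>)"
    using assms(2) by (subst (asm) lborel_has_bochner_integral_real_affine_iff[where c = q and t = 0]) auto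
  then have *: "has_bochner_integral lborel
      (\<lambda>x. q powr (1 - s) * (indicator {0..} (0 + q * x) * (0 + q * x) powr (s - 1) / exp (0 + q * x)))
      (q powr (1 - s) * (Gamma s /\<^sub>R \<bar>q\<bar>))"
    by (intro has_bochner_integral_mult_right) auto
  have "q powr (1 - s) * (Gamma s /\<^sub>R \<bar>q\<bar>) = Gamma s / q powr s"
    using assms(2) by (simp add: powr_diff field_simps)
  \<comment> \<open>At x = 0 the closed and the open ray agree because \<open>0 powr (s - 1)\<close>
    is 0.\<close>
  moreover have "q powr (1 - s) * (indicator {0..} (0 + q * x) * (0 + q * x) powr (s - 1) / exp (0 + q * x))
      = indicator {0<..} x *\<^sub>R (x powr (s - 1) * exp (- q * x))" for x
    using assms(2)
    by (auto simp: indicator_def powr_mult zero_le_mult_iff powr_diff exp_minus field_simps)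
  ultimately show ?thesis
    using * by (simp only:)
qed

text \<open>The Poisson function is a finite sum, so each summand is a scaled Gamma integral with
  shape k + i and rate p + c. The Pochhammer symbol is the quotient of
  \<open>Gamma (k + real i)\<close> by \<open>Gamma k\<close>.\<close>

lemma has_bochner_integral_poisson_below:
  fixes k p c :: real
  assumes "k > 0" "p > 0" "c \<ge> 0"
  shows "has_bochner_integral lborel
    (\<lambda>x. indicator {0<..} x *\<^sub>R (x powr (k - 1) * poisson_below N (c * x) * exp (- p * x)))
    (Gamma k / (p + c) powr k * (\<Sum>i<N. pochhammer k i / fact i * (c / (p + c)) ^ i))"
proof -
  have q: "p + c > 0"
    using assms by simp
  have "has_bochner_integral lborel
    (\<lambda>x. \<Sum>i<N. c ^ i / fact i *
      (indicator {0<..} x *\<^sub>R (x powr (k + real i - 1) * exp (- (p + c) * x))))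
    (\<Sum>i<N. c ^ i / fact i * (Gamma (k + real i) / (p + c) powr (k + real i)))"
    using assms q
    by (intro has_bochner_integral_sum has_bochner_integral_mult_right
        has_bochner_integral_Gamma_scaled) auto
  moreover have "(\<Sum>i<N. c ^ i / fact i * (Gamma (k + real i) / (p + c) powr (k + real i)))
      = Gamma k / (p + c) powr k * (\<Sum>i<N. pochhammer k i / fact i * (c / (p + c)) ^ i)"
    unfolding sum_distrib_left
  proof (rule sum.cong[OF refl])
    fix i
    have "Gamma (k + real i) = pochhammer k i * Gamma k"
      using assms(1) Gamma_real_pos[OF assms(1)]
      by (subst pochhammer_Gamma) (auto elim!: nonpos_Ints_cases simp del: Gamma_real_pos)
    then show "c ^ i / fact i * (Gamma (k + real i) / (p + c) powr (k + real i))
      = Gamma k / (p + c) powr k * (pochhammer k i / fact i * (c / (p + c)) ^ i)"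
      using q by (simp add: powr_add powr_realpow power_divide mult_ac)
  qed
  moreover have "(\<Sum>i<N. c ^ i / fact i *
      (indicator {0<..} x *\<^sub>R (x powr (k + real i - 1) * exp (- (p + c) * x))))
    = indicator {0<..} x *\<^sub>R (x powr (k - 1) * poisson_below N (c * x) * exp (- p * x))" for x
  proof (cases "x > 0")
    case True
    have "x powr (k + real i - 1) = x powr (k - 1) * x ^ i" for i
      using True by (simp add: powr_add[symmetric] powr_realpow[symmetric] algebra_simps)
    moreover have "exp (- (p + c) * x) = exp (- (c * x)) * exp (- p * x)"
      by (simp add: exp_add[symmetric] algebra_simps)
    ultimately show ?thesis
      using True
      by (simp add: poisson_below_def sum_distrib_left sum_distrib_right power_mult_distrib mult_ac)
  qed simp
  ultimately show ?thesis by simp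
qed

section \<open>Rearrangement of double series\<close>

text \<open>Tonelli for series: convergent rows with summable row sums make the family summable over
  all pairs, a condition symmetric in the two indices.\<close>

lemma suminf_swap_nonneg:
  fixes f :: "nat \<Rightarrow> nat \<Rightarrow> real"
  assumes nonneg: "\<And>i j. f i j \<ge> 0"
    and inner: "\<And>i. summable (f i)"
    and outer: "summable (\<lambda>i. \<Sum>j. f i j)"
  shows "summable (\<lambda>j. \<Sum>i. f i j)" "(\<Sum>i. \<Sum>j. f i j) = (\<Sum>j. \<Sum>i. f i j)"
proof -
  have hs: "(g has_sum suminf g) UNIV" if "summable g" "\<And>i. g i \<ge> 0" for g :: "nat \<Rightarrow> real"
    using that by (intro norm_summable_imp_has_sum summable_sums) auto
  have sm: "(\<lambda>(i, j). f i j) summable_on (UNIV \<times> UNIV)"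
    by (rule summable_on_SigmaI[where g = "\<lambda>i. \<Sum>j. f i j"])
       (use nonneg inner outer in \<open>auto intro!: hs simp: summable_on_UNIV_nonneg_real_iff suminf_nonneg\<close>)
  then have sm': "(\<lambda>(j, i). f i j) summable_on (UNIV \<times> UNIV)"
    by (subst summable_on_swap) (simp add: case_prod_unfold)
  have inner': "summable (\<lambda>i. f i j)" for j
    using summable_on_SigmaD1[OF sm', of j] nonneg by (simp add: summable_on_UNIV_nonneg_real_iff)
  have i: "infsum (f i) UNIV = (\<Sum>j. f i j)" for i
    by (intro infsumI hs inner nonneg)
  have j: "infsum (\<lambda>i. f i j) UNIV = (\<Sum>i. f i j)" for j
    by (intro infsumI hs inner' nonneg)
  show outer': "summable (\<lambda>j. \<Sum>i. f i j)"
    using summable_on_Sigma_banach[OF sm'] by (auto simp: j dest: summable_on_imp_summable)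
  have "(\<Sum>i. \<Sum>j. f i j) = infsum (\<lambda>i. infsum (f i) UNIV) UNIV"
    unfolding i by (intro infsumI[symmetric] hs outer suminf_nonneg inner nonneg)
  also have "\<dots> = infsum (\<lambda>j. infsum (\<lambda>i. f i j) UNIV) UNIV"
    by (rule infsum_swap_banach[OF sm])
  also have "\<dots> = (\<Sum>j. \<Sum>i. f i j)"
    unfolding j by (intro infsumI hs outer' suminf_nonneg inner' nonneg)
  finally show "(\<Sum>i. \<Sum>j. f i j) = (\<Sum>j. \<Sum>i. f i j)" .
qed

text \<open>Each partial sum is the full sum minus a tail. The full sums contribute
  \<open>exp w * suminf h\<close>; the weighted tails, summed in the other order, are the values of
  \<open>\<Phi>\<close> at the indices from \<open>m\<close> on.\<close>

lemma exp_weighted_partial_sums: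
  fixes h :: "nat \<Rightarrow> real"
  assumes h: "\<And>i. h i \<ge> 0" "summable h" and w: "w \<ge> 0"
  defines "\<Phi> \<equiv> \<lambda>n. \<Sum>l. w ^ l / fact l * h (n + l)"
  shows "(\<Sum>j. w ^ j / fact j * (\<Sum>i<j + m. h i)) = exp w * suminf h - (suminf \<Phi> - (\<Sum>n<m. \<Phi> n))"
proof -
  let ?f = "\<lambda>l n. w ^ l / fact l * h (n + m + l)"
  have ew: "(\<lambda>j. w ^ j / fact j) sums exp w"
    using exp_converges[of w] by (simp add: field_simps)
  have tail: "summable (\<lambda>n. h (n + m + l))" for l
    using summable_ignore_initial_segment[OF h(2), of "m + l"] by (simp add: add.assoc)
  have split: "(\<Sum>i<j + m. h i) = suminf h - (\<Sum>n. h (n + m + j))" for j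
    using suminf_split_initial_segment[OF h(2), of "j + m"] by (simp add: add_ac)
  have inner_eq: "(\<Sum>n. ?f l n) = w ^ l / fact l * (\<Sum>n. h (n + m + l))" for l
    by (rule suminf_mult[OF tail])
  have outer: "summable (\<lambda>l. \<Sum>n. ?f l n)"
    unfolding inner_eq
  proof (rule summable_comparison_test')
    show "summable (\<lambda>l. w ^ l / fact l * suminf h)"
      by (intro summable_mult2 sums_summable[OF ew])
    fix l
    have "(\<Sum>n. h (n + m + l)) \<le> suminf h"
      using split[of l] sum_nonneg[of "{..<l + m}" h] h(1) by simp
    moreover have "(\<Sum>n. h (n + m + l)) \<ge> 0"
      by (intro suminf_nonneg tail h)
    ultimately show "norm (w ^ l / fact l * (\<Sum>n. h (n + m + l))) \<le> w ^ l / fact l * suminf h"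
      using w by (simp add: abs_mult mult_left_mono divide_right_mono)
  qed
  have f0: "?f l n \<ge> 0" for l n
    using h w by simp
  note swap = suminf_swap_nonneg[of ?f, OF f0 summable_mult[OF tail] outer]
  \<comment> \<open>The exchange yields summability of the shifted sequence only; finitely many
    initial terms do not affect it.\<close>
  have "summable \<Phi>"
    using swap(1) unfolding summable_iff_shift[of \<Phi> m, symmetric] by (simp add: \<Phi>_def)
  from suminf_minus_initial_segment[OF this, of m]
  have \<Phi>: "(\<Sum>l. \<Sum>n. ?f l n) = suminf \<Phi> - (\<Sum>n<m. \<Phi> n)"
    using swap(2) by (simp add: \<Phi>_def)
  have "(\<lambda>j. w ^ j / fact j * suminf h - (\<Sum>n. ?f j n)) sums (exp w * suminf h - (\<Sum>l. \<Sum>n. ?f l n))"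
    by (intro sums_diff sums_mult2 ew summable_sums outer)
  from sums_unique[OF this] show ?thesis
    unfolding \<Phi> unfolding split inner_eq right_diff_distrib by simp
qed

section \<open>Binomial series and hypergeometric coefficients\<close>

lemma negative_binomial_series:
  fixes k x :: real
  assumes "\<bar>x\<bar> < 1"
  shows "(\<lambda>n. pochhammer k n / fact n * x ^ n) sums (1 - x) powr (- k)"
proof -
  have "(- k gchoose n) * (- x) ^ n = pochhammer k n / fact n * x ^ n" for n
    by (simp add: gbinomial_pochhammer power_mult_distrib[symmetric] flip: mult.assoc)
  then show ?thesis
    using gen_binomial_real[of "- x" "- k"] assms by simp
qed

lemma humbert_coeff:
  fixes k :: real
  shows "pochhammer k (n + l) * pochhammer 1 n / pochhammer 1 (n + l) * x ^ n / fact n * y ^ l / fact l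
    = pochhammer k (n + l) / fact (n + l) * x ^ n * y ^ l / fact l"
  by (simp add: pochhammer_fact[symmetric])

text \<open>Both the Pochhammer symbol and the factorial split at \<open>n\<close>: (k)_(n+l) =
  (k)_n (k+n)_l and (n+l)! = n! (n+1)_l. So a weighted Kummer series is one row of the Humbert
  series.\<close>

lemma kummer_coeff:
  fixes k :: real
  shows "pochhammer k n / fact n * (pochhammer (k + real n) l / pochhammer (real n + 1) l)
    = pochhammer k (n + l) / fact (n + l)"
proof -
  have "pochhammer 1 (n + l) = pochhammer 1 n * pochhammer (real n + 1) l"
    using pochhammer_product'[of "1::real" n l] by (simp add: add.commute)
  then show ?thesis
    by (simp add: pochhammer_product'[of k n l] pochhammer_fact)
qed

section \<open>The Laplace-type integral as a series\<close>

text \<open>The mixture is integrated term by term. Replacing each probability by 1 gives the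
  integrable majorant \<open>B\<close>, and the weights \<open>v j\<close> are summable, which
  justifies the exchange.\<close>

lemma calG_eq_series:
  fixes a b k p :: real
  assumes "m \<ge> 1" "k > 0" "p > 0"
  defines "w \<equiv> a\<^sup>2 / 2" and "c \<equiv> b\<^sup>2 / 2"
  shows "calG k m a b p = exp (- w) * (Gamma k / (p + c) powr k) *
    (\<Sum>j. w ^ j / fact j * (\<Sum>i<j + m. pochhammer k i / fact i * (c / (p + c)) ^ i))"
proof -
  have w: "w \<ge> 0" and c: "c \<ge> 0"
    by (simp_all add: w_def c_def)
  define G where "G N x = indicator {0<..} x *\<^sub>R (x powr (k - 1) * poisson_below N (c * x) * exp (- p * x))"
    for N and x :: real
  define v where "v j = exp (- w) * (w ^ j / fact j)" for j
  have v: "v j \<ge> 0" for j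
    using w by (simp add: v_def)
  have sv: "summable v"
    unfolding v_def using summable_exp[of w] by (intro summable_mult) (simp add: field_simps)
  define B where "B x = indicator {0<..} x *\<^sub>R (x powr (k - 1) * exp (- p * x))" for x :: real
  have B: "has_bochner_integral lborel B (Gamma k / p powr k)"
    unfolding B_def by (rule has_bochner_integral_Gamma_scaled) fact+
  have G: "has_bochner_integral lborel (G N)
      (Gamma k / (p + c) powr k * (\<Sum>i<N. pochhammer k i / fact i * (c / (p + c)) ^ i))" for N
    unfolding G_def by (rule has_bochner_integral_poisson_below) fact+
  have GB: "0 \<le> G N x" "G N x \<le> B x" for N x
  proof -
    have *: "0 \<le> poisson_below N (c * x)" "poisson_below N (c * x) \<le> 1" if "x > 0"
      using that c by (auto intro!: poisson_below_nonneg poisson_below_le_1)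
    show "0 \<le> G N x"
      using * by (simp add: G_def indicator_def)
    have "x powr (k - 1) * poisson_below N (c * x) * exp (- p * x)
        \<le> x powr (k - 1) * 1 * exp (- p * x)" if "x > 0"
      using * that by (intro mult_mono) auto
    then show "G N x \<le> B x"
      by (simp add: G_def B_def indicator_def)
  qed
  have "calG k m a b p = (\<integral>x. (\<Sum>j. v j * G (j + m) x) \<partial>lborel)"
    unfolding calG_def set_lebesgue_integral_def
  proof (intro Bochner_Integration.integral_cong refl)
    fix x :: real
    show "indicator {0<..} x *\<^sub>R (x powr (k - 1) * marcumQ m a (b * sqrt x) * exp (- p * x))
        = (\<Sum>j. v j * G (j + m) x)"
    proof (cases "x > 0")
      case True
      have u: "(b * sqrt x)\<^sup>2 / 2 = c * x"
        using True by (simp add: c_def power_mult_distrib)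
      have sm: "summable (\<lambda>j. w ^ j / fact j * poisson_below (j + m) (c * x))"
        using True c by (intro summable_poisson_mixture) simp
      have "marcumQ m a (b * sqrt x) = exp (- w) * (\<Sum>j. w ^ j / fact j * poisson_below (j + m) (c * x))"
        using marcumQ_eq[OF assms(1), of a "b * sqrt x"] unfolding u by (simp add: w_def)
      then have "indicator {0<..} x *\<^sub>R (x powr (k - 1) * marcumQ m a (b * sqrt x) * exp (- p * x))
        = (exp (- w) * x powr (k - 1) * exp (- p * x)) * (\<Sum>j. w ^ j / fact j * poisson_below (j + m) (c * x))"
        using True by (simp add: mult_ac)
      also have "\<dots> = (\<Sum>j. (exp (- w) * x powr (k - 1) * exp (- p * x)) *
          (w ^ j / fact j * poisson_below (j + m) (c * x)))"
        by (rule suminf_mult[OF sm, symmetric])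
      also have "\<dots> = (\<Sum>j. v j * G (j + m) x)"
        using True by (simp add: v_def G_def mult_ac)
      finally show ?thesis .
    qed (simp add: G_def)
  qed
  also have "\<dots> = (\<Sum>j. \<integral>x. v j * G (j + m) x \<partial>lborel)"
  proof (rule integral_suminf)
    show int: "integrable lborel (\<lambda>x. v j * G (j + m) x)" for j
      using integrable.intros[OF G[of "j + m"]] by simp
    have bd: "norm (v j * G (j + m) x) \<le> v j * B x" for j x
      using v[of j] GB[of "j + m" x] by (simp add: mult_left_mono)
    show "AE x in lborel. summable (\<lambda>j. norm (v j * G (j + m) x))"
    proof (rule AE_I2)
      fix x
      show "summable (\<lambda>j. norm (v j * G (j + m) x))"
        by (rule summable_comparison_test'[OF summable_mult2[OF sv, of "B x"]]) (use bd in simp)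
    qed
    show "summable (\<lambda>j. \<integral>x. norm (v j * G (j + m) x) \<partial>lborel)"
    proof (rule summable_comparison_test'[OF summable_mult2[OF sv, of "Gamma k / p powr k"]])
      fix j
      have "(\<integral>x. norm (v j * G (j + m) x) \<partial>lborel) \<le> (\<integral>x. v j * B x \<partial>lborel)"
        using int B bd
        by (intro integral_mono integrable_mult_right integrable_norm)
           (auto intro: integrable.intros)
      also have "\<dots> = v j * (Gamma k / p powr k)"
        using has_bochner_integral_integral_eq[OF B] by simp
      finally show "norm (\<integral>x. norm (v j * G (j + m) x) \<partial>lborel) \<le> v j * (Gamma k / p powr k)"
        by simp
    qed
  qed
  also have "\<dots> = (\<Sum>j. exp (- w) * (Gamma k / (p + c) powr k) *
      (w ^ j / fact j * (\<Sum>i<j + m. pochhammer k i / fact i * (c / (p + c)) ^ i)))"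
    using has_bochner_integral_integral_eq[OF G] by (simp add: v_def mult_ac)
  also have "\<dots> = exp (- w) * (Gamma k / (p + c) powr k) *
      (\<Sum>j. w ^ j / fact j * (\<Sum>i<j + m. pochhammer k i / fact i * (c / (p + c)) ^ i))"
  proof (rule suminf_mult, rule summable_comparison_test')
    let ?h = "\<lambda>i. pochhammer k i / fact i * (c / (p + c)) ^ i"
    have X: "0 \<le> c / (p + c)" "c / (p + c) < 1"
      using assms(3) c by (auto simp: field_simps)
    then have sh: "summable ?h"
      by (intro sums_summable[OF negative_binomial_series]) (simp del: abs_divide)
    have h0: "?h i \<ge> 0" for i
      using X assms(2) by (intro mult_nonneg_nonneg divide_nonneg_nonneg pochhammer_nonneg) auto
    show "summable (\<lambda>j. w ^ j / fact j * suminf ?h)"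
      using summable_exp[of w] by (intro summable_mult2) (simp add: field_simps)
    fix j
    have "(\<Sum>i<j + m. ?h i) \<le> suminf ?h"
      by (intro sum_le_suminf sh h0) auto
    moreover have "(\<Sum>i<j + m. ?h i) \<ge> 0"
      by (intro sum_nonneg h0)
    ultimately show "norm (w ^ j / fact j * (\<Sum>i<j + m. ?h i)) \<le> w ^ j / fact j * suminf ?h"
      using w unfolding real_norm_def abs_mult by (intro mult_mono) auto
  qed
  finally show ?thesis .
qed

section \<open>Closed form\<close>

theorem theorem1:
  fixes a b k p :: real and m :: nat
  assumes "m \<ge> 1" and "k > 0" and "p > 0"
  shows "calG k m a b p =
    Gamma k / p powr k
    - (2 / (b\<^sup>2 + 2 * p)) powr k * exp (- a\<^sup>2 / 2) * Gamma k *
      (humbertPhi1 k 1 1 (b\<^sup>2 / (b\<^sup>2 + 2 * p)) (a\<^sup>2 * b\<^sup>2 / (2 * b\<^sup>2 + 4 * p))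
       - (\<Sum>n<m. pochhammer k n / fact n * (b\<^sup>2 / (b\<^sup>2 + 2 * p)) ^ n
                  * hyp1F1 (k + real n) (real n + 1) (a\<^sup>2 * b\<^sup>2 / (2 * b\<^sup>2 + 4 * p))))"
proof -
  define w c where "w = a\<^sup>2 / 2" and "c = b\<^sup>2 / 2"
  define X where "X = c / (p + c)"
  define h where "h i = pochhammer k i / fact i * X ^ i" for i
  define \<Phi> where "\<Phi> = (\<lambda>n. \<Sum>l. w ^ l / fact l * h (n + l))"
  have w: "w \<ge> 0" and c: "c \<ge> 0" and q: "p + c > 0"
    using assms(3) by (auto simp: w_def c_def add_pos_nonneg)
  have X: "0 \<le> X" "X < 1"
    using c assms(3) by (auto simp: X_def field_simps)
  have h0: "h i \<ge> 0" for i
    unfolding h_def using X assms(2)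
    by (intro mult_nonneg_nonneg divide_nonneg_nonneg pochhammer_nonneg) auto
  have hs: "h sums (1 - X) powr (- k)"
    unfolding h_def using X by (intro negative_binomial_series) auto
  have den: "b\<^sup>2 + 2 * p = 2 * (p + c)" "2 * b\<^sup>2 + 4 * p = 4 * (p + c)"
    by (simp_all add: c_def)
  have X': "b\<^sup>2 / (b\<^sup>2 + 2 * p) = X"
    unfolding den using q by (simp add: X_def c_def)
  have Y': "a\<^sup>2 * b\<^sup>2 / (2 * b\<^sup>2 + 4 * p) = w * X"
    unfolding den using q by (simp add: X_def c_def w_def)
  have K': "(2 / (b\<^sup>2 + 2 * p)) powr k = 1 / (p + c) powr k"
    unfolding den using q by (simp add: powr_divide powr_mult del: distrib_left_numeral)
  \<comment> \<open>Since the second argument is w X, the powers combine to w^l X^(n+l), as in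
    \<open>h (n + l)\<close>.\<close>
  have humbert: "humbertPhi1 k 1 1 X (w * X) = suminf \<Phi>"
    unfolding humbertPhi1_def humbert_coeff \<Phi>_def h_def
    by (simp add: power_add power_mult_distrib mult_ac)
  have kummer: "pochhammer k n / fact n * X ^ n * hyp1F1 (k + real n) (real n + 1) (w * X) = \<Phi> n" for n
  proof -
    define t where "t = (\<lambda>l. pochhammer (k + real n) l / pochhammer (real n + 1) l * (w * X) ^ l / fact l)"
    define d where "d = pochhammer k n / fact n * X ^ n"
    have eq: "d * t l = w ^ l / fact l * h (n + l)" for l
      unfolding h_def kummer_coeff[symmetric] d_def t_def
      by (simp add: power_add power_mult_distrib mult_ac)
    show ?thesis
    \<comment> \<open>The case d = 0 arises when b = 0 and n > 0. Otherwise the Kummer series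
      converges because its multiple by \<open>d\<close> is dominated termwise by
      \<open>suminf h\<close> times the exponential series.\<close>
    proof (cases "d = 0")
      case True
      then show ?thesis
        unfolding \<Phi>_def eq[symmetric] d_def[symmetric] by simp
    next
      case False
      have "summable (\<lambda>l. w ^ l / fact l * h (n + l))"
      proof (rule summable_comparison_test')
        show "summable (\<lambda>l. w ^ l / fact l * suminf h)"
          using summable_exp[of w] by (intro summable_mult2) (simp add: field_simps)
        fix l
        have "h (n + l) \<le> suminf h"
          using sum_le_suminf[OF sums_summable[OF hs], of "{n + l}"] h0 by simp
        then show "norm (w ^ l / fact l * h (n + l)) \<le> w ^ l / fact l * suminf h"
          using w h0 unfolding real_norm_def abs_mult by (intro mult_mono) auto
      qed
      then have "summable t"
        unfolding eq[symmetric] using False by (simp add: summable_cmult_iff)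
      then have "(\<Sum>l. d * t l) = d * suminf t"
        by (rule suminf_mult)
      then show ?thesis
        unfolding eq by (simp only: \<Phi>_def d_def t_def hyp1F1_def)
    qed
  qed
  \<comment> \<open>The binomial series thus sums to ((p + c) / p)^k, which turns the prefactor (p +
    c)^(-k) into p^(-k).\<close>
  have "1 - X = p / (p + c)"
    using q by (simp add: X_def field_simps)
  then have full: "Gamma k / (p + c) powr k * suminf h = Gamma k / p powr k"
    using q assms(3) sums_unique[OF hs, symmetric] by (simp add: powr_minus powr_divide)
  have "calG k m a b p = exp (- w) * (Gamma k / (p + c) powr k) * (\<Sum>j. w ^ j / fact j * (\<Sum>i<j + m. h i))"
    unfolding h_def X_def w_def c_def by (rule calG_eq_series[OF assms])
  also have "\<dots> = exp (- w) * (Gamma k / (p + c) powr k) *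
      (exp w * suminf h - (suminf \<Phi> - (\<Sum>n<m. \<Phi> n)))"
    using exp_weighted_partial_sums[OF h0 sums_summable[OF hs] w, of m] by (simp add: \<Phi>_def)
  \<comment> \<open>\<open>exp w\<close> cancels against \<open>exp (- w)\<close> in the full sum;
    only the tail keeps the exponential factor.\<close>
  also have "\<dots> = Gamma k / (p + c) powr k * suminf h
      - 1 / (p + c) powr k * exp (- w) * Gamma k * (suminf \<Phi> - (\<Sum>n<m. \<Phi> n))"
    by (simp add: algebra_simps exp_minus add_divide_distrib diff_divide_distrib)
  finally show ?thesis
    unfolding X' Y' K' humbert kummer full by (simp add: w_def)
qed

end
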